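(* Let $M \ge 2$ and $N \ge 1$ be integers, and let $b(n) = \mathcal{B}_{M,N}(n) \bmod M$ for $n \ge 0$. The sequence $(b(n))_{n\ge 0}$ is ultimately periodic if and only if every prime factor of $M$ is also a prime factor of $N$ (equivalently, $\operatorname{rad}(M) \mid \operatorname{rad}(N)$).
   Context: For integers $M\ge 2$, $N \ge 1$ and $n\ge 0$ with base-$M$ expansion $n=\sum_{i\ge 0} d_i(n) M^i$, $d_i(n)\in\{0,\dots,M-1\}$, the base-shifting map is $\mathcal{B}_{M,N}(n) := \sum_{i\ge 0} d_i(n) N^i$ (same digit string, read in base $N$). $\operatorname{rad}(k)$ denotes the product of the distinct prime factors of $k$. A sequence $(b(n))$ is ultimately periodic if there exist $P>0$ and $n_0$ with $b(n+P)=b(n)$ for all $n\ge n_0$. *)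

theory Defs
  imports "HOL-Computational_Algebra.Primes"
begin

definition base_digit :: "nat \<Rightarrow> nat \<Rightarrow> nat \<Rightarrow> nat" where
  "base_digit M i n = (n div M ^ i) mod M"

text \<open>
  The series over all \<open>i\<close> is taken over the positions of the nonzero digits, since a sum over an
  infinite index set would be zero by convention. For \<open>M \<ge> 2\<close> the index set is finite, and the
  nonzero digits do represent \<open>n\<close> in base \<open>M\<close>; see the two lemmas below.
\<close>

definition base_shift :: "nat \<Rightarrow> nat \<Rightarrow> nat \<Rightarrow> nat" where
  "base_shift M N n = (\<Sum>i | base_digit M i n \<noteq> 0. base_digit M i n * N ^ i)"

lemma finite_nonzero_digits:
  assumes "M \<ge> 2"
  shows "finite {i. base_digit M i n \<noteq> 0}"
proof (rule finite_subset)
  show "{i. base_digit M i n \<noteq> 0} \<subseteq> {..<n}"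
  proof (rule subsetI, rule ccontr)
    fix i assume i: "i \<in> {i. base_digit M i n \<noteq> 0}" and "i \<notin> {..<n}"
    then have "n < M ^ i"
      using power_gt_expt[of M i] assms by simp
    with i show False
      by (simp add: base_digit_def)
  qed
qed simp

lemma base_shift_same:
  assumes "M \<ge> 2"
  shows "base_shift M M n = n"
proof -
  have partial: "(\<Sum>i<k. base_digit M i n * M ^ i) = n mod M ^ k" for k
  proof (induction k)
    case (Suc k)
    have "n mod M ^ Suc k = M ^ k * (n div M ^ k mod M) + n mod M ^ k"
      by (simp add: mod_mult2_eq mult.commute[of M])
    with Suc show ?case
      by (simp add: base_digit_def mult.commute)
  qed simp
  have lt: "n < M ^ n"
    using power_gt_expt[of M n] assms by simp
  have "{i. base_digit M i n \<noteq> 0} \<subseteq> {..<n}"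
  proof (rule subsetI, rule ccontr)
    fix i assume i: "i \<in> {i. base_digit M i n \<noteq> 0}" and "i \<notin> {..<n}"
    then have "n < M ^ i"
      using power_gt_expt[of M i] assms by simp
    with i show False
      by (simp add: base_digit_def)
  qed
  then have "base_shift M M n = (\<Sum>i<n. base_digit M i n * M ^ i)"
    unfolding base_shift_def by (intro sum.mono_neutral_left) auto
  also have "\<dots> = n"
    using partial[of n] lt by simp
  finally show ?thesis .
qed

definition rad :: "nat \<Rightarrow> nat" where
  "rad k = \<Prod>(prime_factors k)"

definition ultimately_periodic :: "(nat \<Rightarrow> 'a) \<Rightarrow> bool" where
  "ultimately_periodic b \<longleftrightarrow> (\<exists>P>0. \<exists>n0. \<forall>n\<ge>n0. b (n + P) = b n)"

end

(* If M divides N^k, then modulo M only the last k digits of n matter, so M^k is a period.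
   Conversely let P be a period with leading digit d in position t. Adding P to M^L for large L
   causes no carry, so base_shift P vanishes modulo M; adding P to M^L + (M - d) M^t causes exactly
   one carry, out of position t. Comparing the two gives N^(t+1) = M N^t = 0 modulo M, so every
   prime factor of M divides N. *)

theory Submission
  imports Defs "HOL-Number_Theory.Cong"
begin

text \<open>Every position \<open>i \<ge> n\<close> holds the digit 0, because
  \<open>n < M ^ i\<close>. The bound \<open>K\<close> is left free so that the sums for
  \<open>n\<close> and for \<open>n div M\<close> can be taken over a common range.\<close>

lemma base_shift_eq_sum_lessThan:
  assumes "M \<ge> 2" and "n \<le> K"
  shows "base_shift M N n = (\<Sum>i<K. base_digit M i n * N ^ i)"
proof -
  have "base_digit M i n = 0" if "K \<le> i" for i
  proof -
    have "n < M ^ i"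
      using power_gt_expt[of M i] assms that by simp
    then show ?thesis
      by (simp add: base_digit_def)
  qed
  then have "{i. base_digit M i n \<noteq> 0} \<subseteq> {..<K}"
    by (metis (mono_tags, lifting) lessThan_iff linorder_not_less mem_Collect_eq subsetI)
  then show ?thesis
    unfolding base_shift_def by (intro sum.mono_neutral_left) auto
qed

lemma base_shift_rec:
  assumes "M \<ge> 2"
  shows "base_shift M N n = n mod M + N * base_shift M N (n div M)"
proof -
  have digit: "base_digit M (Suc i) n = base_digit M i (n div M)" for i
    by (simp add: base_digit_def div_mult2_eq)
  \<comment> \<open>With \<open>Suc n\<close> terms, splitting off position 0 leaves
    \<open>n\<close> terms, enough for \<open>n div M\<close> since it is at most
    \<open>n\<close>.\<close>
  have "base_shift M N n = (\<Sum>i<Suc n. base_digit M i n * N ^ i)"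
    by (rule base_shift_eq_sum_lessThan) (use assms in auto)
  also have "\<dots> = n mod M + N * (\<Sum>i<n. base_digit M i (n div M) * N ^ i)"
    unfolding sum.lessThan_Suc_shift
    by (simp add: digit sum_distrib_left ac_simps) (simp add: base_digit_def)
  also have "(\<Sum>i<n. base_digit M i (n div M) * N ^ i) = base_shift M N (n div M)"
    by (rule base_shift_eq_sum_lessThan[symmetric]) (use assms in auto)
  finally show ?thesis .
qed

lemma base_shift_digit:
  assumes "M \<ge> 2" and "d < M"
  shows "base_shift M N d = d"
proof -
  have "base_shift M N 0 = 0"
    by (simp add: base_shift_def base_digit_def)
  then show ?thesis
    using base_shift_rec[OF assms(1), of N d] assms by simp
qed

text \<open>The digits of \<open>M ^ k * x + r\<close> are those of \<open>x\<close> followed by a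
  block of \<open>k\<close> digits holding \<open>r\<close>, padded with zeros. The induction strips
  the lowest digit, which belongs to \<open>r\<close>. Carry-free additions are evaluated by this
  rule.\<close>

lemma base_shift_append:
  assumes "M \<ge> 2" and "r < M ^ k"
  shows "base_shift M N (M ^ k * x + r) = N ^ k * base_shift M N x + base_shift M N r"
  using assms(2)
proof (induction k arbitrary: r)
  case 0
  then show ?case
    using base_shift_digit[OF assms(1), of 0 N] assms(1) by simp
next
  case (Suc k)
  have shifted: "M ^ Suc k * x + r = r + M * (M ^ k * x)"
    by simp
  have quot: "(M ^ Suc k * x + r) div M = M ^ k * x + r div M"
    unfolding shifted using assms(1) by (subst div_mult_self2) auto
  have rest: "(M ^ Suc k * x + r) mod M = r mod M"
    unfolding shifted by simp
  have "r div M < M ^ k"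
    using Suc.prems by (simp add: less_mult_imp_div_less mult.commute)
  then show ?case
    using base_shift_rec[OF assms(1), of N "M ^ Suc k * x + r"]
      base_shift_rec[OF assms(1), of N r] Suc.IH[of "r div M"]
    unfolding quot rest by (simp add: algebra_simps)
qed

lemma base_shift_mod_ultimately_periodic:
  assumes "M \<ge> 2" and "M dvd N ^ k"
  shows "ultimately_periodic (\<lambda>n. base_shift M N n mod M)"
proof -
  have low: "base_shift M N n mod M = base_shift M N (n mod M ^ k) mod M" for n
  proof -
    have "base_shift M N n = N ^ k * base_shift M N (n div M ^ k) + base_shift M N (n mod M ^ k)"
      using base_shift_append[of M "n mod M ^ k" k N "n div M ^ k"] assms(1) by simp
    moreover obtain c where "N ^ k = M * c"
      using assms(2) by (elim dvdE)
    ultimately show ?thesis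
      by (simp add: mult.assoc)
  qed
  \<comment> \<open>Adding \<open>M ^ k\<close> leaves the last \<open>k\<close> digits alone. This
    holds for every \<open>n\<close>, so any threshold serves.\<close>
  have "base_shift M N (n + M ^ k) mod M = base_shift M N n mod M" for n
    using low[of n] low[of "n + M ^ k"] by simp
  then show ?thesis
    unfolding ultimately_periodic_def using assms(1)
    by (intro exI[of _ "M ^ k"]) auto
qed

lemma ultimately_periodic_imp_dvd_power:
  assumes M: "M \<ge> 2" and per: "ultimately_periodic (\<lambda>n. base_shift M N n mod M)"
  shows "\<exists>k. M dvd N ^ k"
proof -
  let ?B = "base_shift M N"
  obtain P n0 where "P > 0"
    and P: "\<And>n. n \<ge> n0 \<Longrightarrow> [?B (n + P) = ?B n] (mod M)"
    using per unfolding ultimately_periodic_def cong_def by auto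
  obtain t where t: "M ^ t \<le> P" "P < M ^ Suc t"
    using ex_power_ivl1[of M P] M \<open>P > 0\<close> by auto
  define d where "d = P div M ^ t"
  define r where "r = P mod M ^ t"
  have P_eq: "P = M ^ t * d + r" and r: "r < M ^ t"
    using M by (auto simp: d_def r_def)
  have d: "0 < d" "d < M"
    using t M by (auto simp: d_def div_greater_zero_iff less_mult_imp_div_less)
  \<comment> \<open>The summand \<open>n0\<close> puts \<open>M ^ L\<close> beyond the threshold, as
    \<open>L < M ^ L\<close>. The summand \<open>t + 2\<close> keeps the digit 1 in position
    \<open>L\<close> clear of every number below \<open>M ^ (t + 2)\<close>, in particular of
    \<open>P\<close>, \<open>m\<close> and \<open>m + P\<close>.\<close>
  define L where "L = n0 + Suc (Suc t)"
  have "n0 < M ^ L"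
    using power_gt_expt[of M L] M by (simp add: L_def)
  have less_L: "a < M ^ L" if "a < M ^ Suc (Suc t)" for a
    by (rule less_le_trans[OF that]) (use M in \<open>intro power_increasing; simp add: L_def\<close>)
  have B1: "?B 1 = 1"
    using base_shift_digit[of M 1 N] M by simp
  have high: "?B (M ^ L + a) = N ^ L + ?B a" if "a < M ^ Suc (Suc t)" for a
    using base_shift_append[OF M less_L[OF that], of N 1] B1 by simp
  have digit: "?B (M ^ t * e + s) = N ^ t * e + ?B s" if "e < M" "s < M ^ t" for e s
    using base_shift_append[OF M that(2), of N e] base_shift_digit[OF M that(1)] by simp
  have B0: "?B 0 = 0"
    using base_shift_digit[of M 0 N] M by simp
  have r': "r < M ^ Suc t"
    using P_eq t(2) by linarith
  \<comment> \<open>As \<open>M \<ge> 2\<close>, a sum of two numbers below \<open>M ^ Suc t\<close>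
    still fits below position \<open>t + 2\<close>, even after a carry.\<close>
  have pow_less: "M ^ Suc t + M ^ Suc t \<le> M ^ Suc (Suc t)"
    using mult_le_mono1[OF M, of "M ^ Suc t"] by (simp only: mult_2 power_Suc)
  \<comment> \<open>\<open>M - d\<close> complements the leading digit of \<open>P\<close>, and
    \<open>d > 0\<close> makes it a valid digit. In \<open>m + P\<close> position \<open>t\<close>
    becomes 0, a 1 moves to position \<open>t + 1\<close>, and \<open>r\<close> is
    untouched.\<close>
  define m where "m = M ^ t * (M - d)"
  have "m + P = M ^ t * ((M - d) + d) + r"
    unfolding m_def P_eq by (simp only: distrib_left add.assoc)
  then have carry: "m + P = M ^ Suc t * 1 + r"
    using d by simp
  have "?B P = N ^ t * d + ?B r"
    unfolding P_eq by (rule digit[OF d(2) r])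
  moreover have "P < M ^ Suc (Suc t)"
    using t(2) pow_less by linarith
  ultimately have "?B (M ^ L + P) = N ^ L + (N ^ t * d + ?B r)"
    using high by metis
  moreover have "?B (M ^ L) = N ^ L + 0"
    using high[of 0] B0 M by simp
  ultimately have "[N ^ L + (N ^ t * d + ?B r) = N ^ L + 0] (mod M)"
    using P[of "M ^ L"] \<open>n0 < M ^ L\<close> by (metis less_imp_le)
  then have no_carry: "[N ^ t * d + ?B r = 0] (mod M)"
    by (simp only: cong_add_lcancel_nat)
  have m_val: "?B m = N ^ t * (M - d)"
    unfolding m_def using digit[of "M - d" 0] d B0 M by simp
  have mP_val: "?B (m + P) = N ^ Suc t + ?B r"
    unfolding carry using base_shift_append[OF M r', of N 1] B1 by simp
  have mP_less: "m + P < M ^ Suc (Suc t)"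
    using carry r' pow_less by linarith
  have "[?B (M ^ L + (m + P)) = ?B (M ^ L + m)] (mod M)"
    using P[of "M ^ L + m"] \<open>n0 < M ^ L\<close> by (simp add: add.assoc)
  then have "[N ^ L + (N ^ Suc t + ?B r) = N ^ L + N ^ t * (M - d)] (mod M)"
    using high[of "m + P"] high[of m] mP_less m_val mP_val by simp
  then have one_carry: "[N ^ Suc t + ?B r = N ^ t * (M - d)] (mod M)"
    by (simp only: cong_add_lcancel_nat)
  \<comment> \<open>Adding \<open>N ^ t * d\<close> to both sides completes the image of
    \<open>P\<close> on the left, which vanishes by \<open>no_carry\<close>, and turns the right
    side into \<open>N ^ t * M\<close>.\<close>
  have "[N ^ Suc t + (N ^ t * d + ?B r) = N ^ t * (M - d) + N ^ t * d] (mod M)"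
    using cong_add[OF one_carry cong_refl[of "N ^ t * d"]]
    by (metis (no_types) add.assoc add.commute)
  moreover have "N ^ t * (M - d) + N ^ t * d = N ^ t * M"
    using d by (simp flip: distrib_left)
  moreover have "[N ^ Suc t + (N ^ t * d + ?B r) = N ^ Suc t + 0] (mod M)"
    using no_carry by (simp only: cong_add_lcancel_nat)
  ultimately have "[N ^ Suc t = N ^ t * M] (mod M)"
    by (metis add_0_right cong_sym cong_trans)
  then have "M dvd N ^ Suc t"
    using cong_dvd_iff by (metis dvd_triv_right)
  then show ?thesis
    by blast
qed

lemma ex_dvd_power_iff:
  fixes M N :: nat
  assumes "M > 0" and "N > 0"
  shows "(\<exists>k. M dvd N ^ k) \<longleftrightarrow> (\<forall>p. prime p \<and> p dvd M \<longrightarrow> p dvd N)"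
proof
  assume "\<exists>k. M dvd N ^ k"
  then show "\<forall>p. prime p \<and> p dvd M \<longrightarrow> p dvd N"
    using dvd_trans prime_dvd_power by blast
next
  assume primes: "\<forall>p. prime p \<and> p dvd M \<longrightarrow> p dvd N"
  \<comment> \<open>The exponent \<open>M\<close> is large enough for all primes at once: if
    \<open>p\<close> divides \<open>M\<close> with multiplicity \<open>v\<close>, then
    \<open>v < p ^ v \<le> M\<close>, while \<open>p\<close> occurs at least \<open>M\<close> times
    in \<open>N ^ M\<close>.\<close>
  have "M dvd N ^ M"
  proof (rule multiplicity_le_imp_dvd)
    fix p :: nat assume p: "prime p"
    show "multiplicity p M \<le> multiplicity p (N ^ M)"
    proof (cases "p dvd M")
      case True
      have "p ^ multiplicity p M \<le> M"
        using assms by (intro dvd_imp_le multiplicity_dvd)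
      then have "multiplicity p M \<le> M"
        using power_gt_expt[of p "multiplicity p M"] prime_gt_1_nat[OF p] by simp
      also have "1 \<le> multiplicity p N"
        using True primes p assms by (simp add: Suc_le_eq prime_multiplicity_gt_zero_iff)
      then have "M \<le> M * multiplicity p N"
        by simp
      finally show ?thesis
        using p assms by (simp add: prime_elem_multiplicity_power_distrib)
    qed (simp add: not_dvd_imp_multiplicity_0)
  qed (use assms in simp)
  then show "\<exists>k. M dvd N ^ k" ..
qed

text \<open>Positivity excludes \<open>k = 0\<close>, where \<open>prime_factors\<close> is empty
  and \<open>rad\<close> is 1 although every prime divides 0.\<close>

lemma prime_dvd_rad_iff:
  assumes "k > 0" and "prime p"
  shows "p dvd rad k \<longleftrightarrow> p dvd k"
proof
  assume "p dvd rad k"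
  then obtain q where "q \<in> prime_factors k" "p dvd q"
    using assms(2) by (auto simp: rad_def prime_dvd_prod_iff)
  then show "p dvd k"
    by (meson dvd_trans in_prime_factors_iff)
next
  assume "p dvd k"
  then show "p dvd rad k"
    unfolding rad_def using assms by (intro dvd_prodI) (auto simp: in_prime_factors_iff)
qed

lemma rad_dvd_rad_iff:
  assumes "M > 0" and "N > 0"
  shows "rad M dvd rad N \<longleftrightarrow> (\<forall>p. prime p \<and> p dvd M \<longrightarrow> p dvd N)"
proof
  assume "rad M dvd rad N"
  then show "\<forall>p. prime p \<and> p dvd M \<longrightarrow> p dvd N"
    using prime_dvd_rad_iff assms by (metis dvd_trans)
next
  assume "\<forall>p. prime p \<and> p dvd M \<longrightarrow> p dvd N"
  \<comment> \<open>Both radicals are products over sets of primes, so inclusion of the sets gives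
    divisibility.\<close>
  then have "prime_factors M \<subseteq> prime_factors N"
    using assms by (auto simp: in_prime_factors_iff)
  then show "rad M dvd rad N"
    unfolding rad_def by (intro prod_dvd_prod_subset) auto
qed

theorem theorem2p1:
  fixes M N :: nat
  assumes "M \<ge> 2" and "N \<ge> 1"
  shows "(ultimately_periodic (\<lambda>n. base_shift M N n mod M) \<longleftrightarrow>
            (\<forall>p. prime p \<and> p dvd M \<longrightarrow> p dvd N)) \<and>
         ((\<forall>p. prime p \<and> p dvd M \<longrightarrow> p dvd N) \<longleftrightarrow> rad M dvd rad N)"
proof -
  have pos: "M > 0" "N > 0"
    using assms by auto
  \<comment> \<open>Divisibility of some power of \<open>N\<close> by \<open>M\<close> links
    periodicity to the condition on primes.\<close>
  have "ultimately_periodic (\<lambda>n. base_shift M N n mod M) \<longleftrightarrow> (\<exists>k. M dvd N ^ k)"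
    using base_shift_mod_ultimately_periodic ultimately_periodic_imp_dvd_power assms(1) by blast
  then show ?thesis
    unfolding ex_dvd_power_iff[OF pos] rad_dvd_rad_iff[OF pos] by simp
qed

end
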